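(* Let $n\ge1$ and let $F:\mathbb{S}^n_{++}\to\mathbb{S}^n$, $F(X)=X^{-1}$. Then the following hold: (a) $\hat K_F=K_F=\mathbb{S}^n_+$. (b) $F$ is $\mathbb{S}^n_+$-convex and $\mathbb{S}^n_+$-closed. (c) $\overline{\mathrm{conv}}(\mathrm{gph}\,F)=\mathbb{S}^n_+\text{-}\mathrm{epi}\,F$.
   Context: $\mathbb{S}^n$ is the space of real symmetric $n\times n$ matrices with inner product $\langle X,Y\rangle=\mathrm{tr}(XY)$; $\mathbb{S}^n_+$ (resp. $\mathbb{S}^n_{++}$) is the set of positive semidefinite (resp. positive definite) matrices. For a map $F:D\subset\mathbb{E}_1\to\mathbb{E}_2$ between Euclidean spaces with $D$ nonempty and convex and a cone $K\subset\mathbb{E}_2$ (a nonempty set closed under multiplication by all $\lambda\ge0$), $K\text{-}\mathrm{epi}\,F:=\{(x,y)\in D\times\mathbb{E}_2 : y-F(x)\in K\}$; $F$ is $K$-convex if this set is convex and $K$-closed if it is closed in $\mathbb{E}_1\times\mathbb{E}_2$. $K_F$ is the smallest closed convex cone $K$ such that $F$ is $K$-convex (it always exists). $\hat K_F$ is the smallest closed convex cone $K$ such that $F$ is $K$-convex and $K$-closed (if it exists; statement (a) includes its existence). "Smallest" means contained in every other such closed convex cone. $\mathrm{gph}\,F=\{(X,F(X)) : X\in\mathbb{S}^n_{++}\}$; the closed convex hull $\overline{\mathrm{conv}}$ is taken in $\mathbb{S}^n\times\mathbb{S}^n$. *)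

theory Defs
  imports "HOL-Analysis.Analysis"
begin

text \<open>
  A Euclidean space is represented by a linear subspace \<open>E\<close> of an ambient type of class
  \<^class>\<open>euclidean_space\<close>, and a map \<open>F : D \<rightarrow> E2\<close> by a total function of which only the
  values on \<open>D\<close> matter. Cones in \<open>E2\<close> are subsets of \<open>E2\<close>, and ``closed'' always refers to the
  subspace topology of the represented space.
\<close>

definition K_epi :: "'b::euclidean_space set \<Rightarrow> 'a::euclidean_space set \<Rightarrow> ('a \<Rightarrow> 'b)
    \<Rightarrow> 'b set \<Rightarrow> ('a \<times> 'b) set" where
  "K_epi E2 D F K = {(x, y). x \<in> D \<and> y \<in> E2 \<and> y - F x \<in> K}"

definition K_convex :: "'b::euclidean_space set \<Rightarrow> 'a::euclidean_space set \<Rightarrow> ('a \<Rightarrow> 'b)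
    \<Rightarrow> 'b set \<Rightarrow> bool" where
  "K_convex E2 D F K \<longleftrightarrow> convex (K_epi E2 D F K)"

definition K_closed :: "'a::euclidean_space set \<Rightarrow> 'b::euclidean_space set \<Rightarrow> 'a set
    \<Rightarrow> ('a \<Rightarrow> 'b) \<Rightarrow> 'b set \<Rightarrow> bool" where
  "K_closed E1 E2 D F K \<longleftrightarrow> closedin (top_of_set (E1 \<times> E2)) (K_epi E2 D F K)"

text \<open>\<^const>\<open>convex_cone\<close> includes nonemptiness; \<^const>\<open>closedin\<close> includes \<open>K \<subseteq> E\<close>.\<close>

definition closed_convex_cone_in :: "'b::euclidean_space set \<Rightarrow> 'b set \<Rightarrow> bool" where
  "closed_convex_cone_in E K \<longleftrightarrow> closedin (top_of_set E) K \<and> convex_cone K"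

definition smallest_closed_convex_cone :: "'b::euclidean_space set \<Rightarrow> ('b set \<Rightarrow> bool)
    \<Rightarrow> 'b set \<Rightarrow> bool" where
  "smallest_closed_convex_cone E P K \<longleftrightarrow>
     closed_convex_cone_in E K \<and> P K \<and>
     (\<forall>K'. closed_convex_cone_in E K' \<and> P K' \<longrightarrow> K \<subseteq> K')"

text \<open>
  \<open>is_K E2 D F K\<close> says that \<open>K\<^sub>F\<close> exists and equals \<open>K\<close>;
  \<open>is_K_hat E1 E2 D F K\<close> says the same of the closed variant.
\<close>

definition is_K :: "'b::euclidean_space set \<Rightarrow> 'a::euclidean_space set \<Rightarrow> ('a \<Rightarrow> 'b)
    \<Rightarrow> 'b set \<Rightarrow> bool" where
  "is_K E2 D F K \<longleftrightarrow> smallest_closed_convex_cone E2 (K_convex E2 D F) K"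

definition is_K_hat :: "'a::euclidean_space set \<Rightarrow> 'b::euclidean_space set \<Rightarrow> 'a set
    \<Rightarrow> ('a \<Rightarrow> 'b) \<Rightarrow> 'b set \<Rightarrow> bool" where
  "is_K_hat E1 E2 D F K \<longleftrightarrow>
     smallest_closed_convex_cone E2 (\<lambda>K. K_convex E2 D F K \<and> K_closed E1 E2 D F K) K"

definition gph :: "'a set \<Rightarrow> ('a \<Rightarrow> 'b) \<Rightarrow> ('a \<times> 'b) set" where
  "gph D F = {(x, F x) | x. x \<in> D}"

definition closed_conv_in :: "'a::euclidean_space set \<Rightarrow> 'a set \<Rightarrow> 'a set" where
  "closed_conv_in E S = top_of_set E closure_of (convex hull S)"

definition sym_mats :: "(real^'n^'n) set" where
  "sym_mats = {X. transpose X = X}"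

definition psd_mats :: "(real^'n^'n) set" where
  "psd_mats = {X \<in> sym_mats. \<forall>v. 0 \<le> v \<bullet> (X *v v)}"

definition pd_mats :: "(real^'n^'n) set" where
  "pd_mats = {X \<in> sym_mats. \<forall>v. v \<noteq> 0 \<longrightarrow> 0 < v \<bullet> (X *v v)}"

text \<open>The inner product of the ambient matrix type restricts to the trace inner product.\<close>

lemma inner_sym_mats:
  fixes X Y :: "real^'n^'n"
  assumes "X \<in> sym_mats" "Y \<in> sym_mats"
  shows "X \<bullet> Y = trace (X ** Y)"
proof -
  have *: "Y $ k $ i = Y $ i $ k" for i k
  proof -
    have "transpose Y $ i $ k = Y $ k $ i"
      by (simp add: transpose_def)
    then show ?thesis
      using assms(2) by (simp add: sym_mats_def)
  qed
  have "X \<bullet> Y = (\<Sum>i\<in>UNIV. \<Sum>k\<in>UNIV. X $ i $ k * Y $ i $ k)"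
    by (simp add: inner_vec_def)
  also have "\<dots> = (\<Sum>i\<in>UNIV. \<Sum>k\<in>UNIV. X $ i $ k * Y $ k $ i)"
    by (simp add: *)
  finally show ?thesis
    by (simp add: trace_def matrix_matrix_mult_def)
qed

lemma subspace_sym_mats: "subspace (sym_mats :: (real^'n^'n) set)"
  by (auto simp: subspace_def sym_mats_def transpose_def vec_eq_iff)

end

theory Submission
  imports Defs
begin

text \<open>
  For positive definite \<open>X\<close>, completing the square gives
  \<open>v \<bullet> (X\<inverse> v) = sup\<^sub>w (2 (v \<bullet> w) - w \<bullet> (X w))\<close>, attained at \<open>w = X\<inverse> v\<close>. Hence \<open>Y - X\<inverse>\<close> is
  positive semidefinite if and only if \<open>w \<bullet> (X w) + v \<bullet> (Y v) \<ge> 2 (v \<bullet> w)\<close> for all \<open>v\<close> and \<open>w\<close>.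
  For symmetric \<open>X\<close>, \<open>Y\<close> these inequalities by themselves force \<open>X\<close> to be definite. So the
  epigraph of inversion is an intersection of closed half-spaces in the space of pairs of
  symmetric matrices (\<open>epi_inverse_eq_halfspaces\<close>), and it is therefore closed and convex.

  Minimality of the semidefinite cone comes from restricting inversion to a ray through
  \<open>P\<inverse>\<close>, with \<open>P\<close> definite: there it is \<open>s P\<inverse> \<mapsto> (1/s) P\<close>, and the convexity gap of the strictly
  convex function \<open>s \<mapsto> 1/s\<close> places a positive multiple of \<open>P\<close> in every admissible cone
  (\<open>psd_mats_subset_if_K_convex_inverse\<close>).

  For the closed convex hull, the same ray supplies recession directions: scaling the point
  \<open>(t P\<inverse>, (1/t) P)\<close> of the graph by \<open>t\<close> gives \<open>(t\<^sup>2 P\<inverse>, P)\<close>, which tends to \<open>(0, P)\<close> as \<open>t\<close>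
  decreases to \<open>0\<close>. A closed convex set containing the graph thus contains
  \<open>(X, X\<inverse> + P)\<close> for all definite \<open>X\<close> and \<open>P\<close> (\<open>closed_convex_graph_superset\<close>). In both
  arguments the step from definite to semidefinite \<open>P\<close> is the density of definite matrices in
  the semidefinite ones (\<open>psd_mats_subset_closed\<close>).
\<close>

section \<open>Symmetric, semidefinite and definite matrices\<close>

text \<open>
  The outer product represents evaluation of the bilinear form of a matrix as an inner product,
  so that conditions on quadratic forms become half-spaces in the matrix space.
\<close>

definition outer :: "real^'m \<Rightarrow> real^'n \<Rightarrow> real^'n^'m" where
  "outer v w = (\<chi> i. v $ i *\<^sub>R w)"

lemma inner_outer: "outer v w \<bullet> X = v \<bullet> (X *v w)"
  by (simp add: outer_def inner_vec_def matrix_vector_mult_def sum_distrib_left mult_ac)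

lemma closed_sym_mats: "closed (sym_mats :: (real^'n^'n) set)"
  by (intro closed_subspace subspace_sym_mats)

lemma convex_sym_mats: "convex (sym_mats :: (real^'n^'n) set)"
  by (intro subspace_imp_convex subspace_sym_mats)

lemma psd_mats_eq_halfspaces:
  "psd_mats = sym_mats \<inter> (\<Inter>v. {X :: real^'n^'n. outer v v \<bullet> X \<ge> 0})"
  by (auto simp: psd_mats_def inner_outer)

lemma closed_psd_mats: "closed (psd_mats :: (real^'n^'n) set)"
  unfolding psd_mats_eq_halfspaces
  by (intro closed_Int closed_sym_mats closed_INT ballI closed_halfspace_ge)

lemma convex_cone_psd_mats: "convex_cone (psd_mats :: (real^'n^'n) set)"
proof -
  have "0 \<in> (psd_mats :: (real^'n^'n) set)"
    by (simp add: psd_mats_def subspace_0[OF subspace_sym_mats])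
  moreover have "x + y \<in> psd_mats" if "x \<in> psd_mats" "y \<in> psd_mats" for x y :: "real^'n^'n"
    using that by (auto simp: psd_mats_eq_halfspaces inner_add_right subspace_add[OF subspace_sym_mats])
  moreover have "c *\<^sub>R x \<in> psd_mats" if "x \<in> psd_mats" "0 \<le> c" for x :: "real^'n^'n" and c
    using that by (auto simp: psd_mats_eq_halfspaces subspace_scale[OF subspace_sym_mats])
  ultimately show ?thesis
    by (auto simp: convex_cone_iff)
qed

lemma pd_matsD:
  assumes "X \<in> pd_mats"
  shows "X \<in> sym_mats" "v \<noteq> 0 \<Longrightarrow> 0 < v \<bullet> (X *v v)" "0 \<le> v \<bullet> (X *v v)"
  using assms by (auto simp: pd_mats_def intro: less_imp_le) (metis inner_zero_left less_imp_le order_refl)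

lemma scaleR_pd_mats:
  assumes "X \<in> pd_mats" "0 < c"
  shows "c *\<^sub>R X \<in> pd_mats"
  using assms
  by (auto simp: pd_mats_def subspace_scale[OF subspace_sym_mats]
      simp flip: scaleR_matrix_vector_assoc)

lemma psd_add_identity_pd:
  assumes "P \<in> psd_mats" "0 < e"
  shows "P + e *\<^sub>R mat 1 \<in> pd_mats"
proof -
  have "mat 1 \<in> (sym_mats :: (real^'n^'n) set)"
    by (simp add: sym_mats_def)
  then have "P + e *\<^sub>R mat 1 \<in> sym_mats"
    using assms by (intro subspace_add subspace_scale subspace_sym_mats) (simp_all add: psd_mats_def)
  then show ?thesis
    using assms
    by (auto simp: pd_mats_def psd_mats_def matrix_vector_mult_add_rdistrib inner_add_right
        intro!: add_nonneg_pos simp flip: scaleR_matrix_vector_assoc)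
qed

text \<open>
  Adding a small multiple of the identity makes a semidefinite matrix definite.
\<close>

lemma psd_mats_subset_closed:
  fixes C :: "(real^'n^'n) set"
  assumes "closed C" "pd_mats \<subseteq> C"
  shows "psd_mats \<subseteq> C"
proof
  fix P :: "real^'n^'n"
  assume P: "P \<in> psd_mats"
  have "((\<lambda>e. P + e *\<^sub>R mat 1) \<longlongrightarrow> P + 0 *\<^sub>R mat 1) (at_right (0::real))"
    by (intro tendsto_intros)
  moreover have "\<forall>\<^sub>F e in at_right (0::real). P + e *\<^sub>R mat 1 \<in> C"
    using P assms(2) psd_add_identity_pd
    by (intro eventually_at_rightI[of 0 1]) auto
  ultimately show "P \<in> C"
    using Lim_in_closed_set[OF assms(1), of "\<lambda>e. P + e *\<^sub>R mat 1" "at_right (0::real)"] by simp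
qed

section \<open>Inverses of definite matrices\<close>

lemma matrix_inv_eqI:
  fixes A B :: "real^'n^'n"
  assumes "A ** B = mat 1"
  shows "matrix_inv A = B"
proof -
  have BA: "B ** A = mat 1"
    using assms matrix_left_right_inverse by blast
  have "matrix_inv A ** A = mat 1"
    unfolding matrix_inv_def using someI[of "\<lambda>B. A ** B = mat 1 \<and> B ** A = mat 1" B] assms BA by blast
  then show ?thesis
    using assms by (metis matrix_mul_assoc matrix_mul_lid matrix_mul_rid)
qed

text \<open>
  A definite matrix has trivial kernel, since \<open>X v = 0\<close> makes its quadratic form vanish at \<open>v\<close>.
\<close>

lemma pd_mats_invertible:
  fixes X :: "real^'n^'n"
  assumes "X \<in> pd_mats"
  shows "X ** matrix_inv X = mat 1" "matrix_inv X ** X = mat 1"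
proof -
  have "invertible X"
    unfolding invertible_left_inverse matrix_left_invertible_ker
    using pd_matsD(2)[OF assms] by (metis inner_zero_right less_irrefl)
  then obtain B where "X ** B = mat 1" "B ** X = mat 1"
    by (auto simp: invertible_def)
  with matrix_inv_eqI[of X B] show "X ** matrix_inv X = mat 1" "matrix_inv X ** X = mat 1"
    by simp_all
qed

lemma matrix_inv_cancel:
  assumes "X \<in> pd_mats"
  shows "X *v (matrix_inv X *v v) = v"
  by (simp add: pd_mats_invertible[OF assms] matrix_vector_mul_assoc)

lemma matrix_inv_sym:
  assumes "X \<in> pd_mats"
  shows "matrix_inv X \<in> sym_mats"
proof -
  have "X ** transpose (matrix_inv X) = mat 1"
    using pd_mats_invertible(2)[OF assms] pd_matsD(1)[OF assms]
    by (metis (mono_tags, lifting) matrix_transpose_mul mem_Collect_eq sym_mats_def transpose_mat)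
  then show ?thesis
    using matrix_inv_eqI by (fastforce simp: sym_mats_def)
qed

text \<open>
  The substitution \<open>v = X u\<close> turns the quadratic form of the inverse into \<open>u \<bullet> (X u)\<close>.
\<close>

lemma matrix_inv_pd:
  assumes "X \<in> pd_mats"
  shows "matrix_inv X \<in> pd_mats"
proof -
  have "0 < v \<bullet> (matrix_inv X *v v)" if "v \<noteq> 0" for v
  proof -
    have "matrix_inv X *v v \<noteq> 0"
      using that matrix_inv_cancel[OF assms, of v] by auto
    from pd_matsD(2)[OF assms this] show ?thesis
      by (simp add: matrix_inv_cancel[OF assms] inner_commute)
  qed
  with matrix_inv_sym[OF assms] show ?thesis
    by (simp add: pd_mats_def)
qed

lemma matrix_inv_matrix_inv:
  assumes "P \<in> pd_mats"
  shows "matrix_inv (matrix_inv P) = P"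
  using matrix_inv_eqI pd_mats_invertible(2)[OF assms] .

lemma matrix_inv_scaleR_matrix_inv:
  assumes "P \<in> pd_mats" "c \<noteq> 0"
  shows "matrix_inv (c *\<^sub>R matrix_inv P) = (1 / c) *\<^sub>R P"
  using assms
  by (intro matrix_inv_eqI)
    (simp add: matrix_scalar_ac pd_mats_invertible(2) flip: scalar_matrix_assoc)

lemma sym_mats_inner_commute:
  assumes "X \<in> sym_mats"
  shows "v \<bullet> (X *v w) = w \<bullet> (X *v v)"
  using assms by (metis (mono_tags, lifting) dot_lmul_matrix inner_commute mem_Collect_eq 
     sym_mats_def transpose_matrix_vector)

section \<open>The epigraph of inversion\<close>

text \<open>
  The inequalities say that the block matrix with diagonal blocks \<open>X\<close>, \<open>Y\<close> and off-diagonal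
  blocks \<open>- mat 1\<close> is positive semidefinite, so this is the Schur complement criterion, with the
  definiteness of \<open>X\<close> among its consequences.
\<close>

lemma epi_inverse_eq_halfspaces:
  "K_epi sym_mats pd_mats matrix_inv (psd_mats :: (real^'n^'n) set)
    = (sym_mats \<times> sym_mats) \<inter> (\<Inter>v. \<Inter>w. {Z. (outer w w, outer v v) \<bullet> Z \<ge> 2 * (v \<bullet> w)})"
    (is "?E = ?H")
proof (intro equalityI subsetI)
  fix Z :: "(real^'n^'n) \<times> (real^'n^'n)"
  assume "Z \<in> ?E"
  then obtain X Y where Z: "Z = (X, Y)" and X: "X \<in> pd_mats" and Y: "Y \<in> sym_mats"
    and D: "Y - matrix_inv X \<in> psd_mats"
    by (auto simp: K_epi_def)
  have "2 * (v \<bullet> w) \<le> w \<bullet> (X *v w) + v \<bullet> (Y *v v)" for v w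
  proof -
    \<comment> \<open>The minimiser over \<open>w\<close> of \<open>w \<bullet> (X w) - 2 (v \<bullet> w)\<close>.\<close>
    let ?u = "matrix_inv X *v v"
    have "0 \<le> (w - ?u) \<bullet> (X *v (w - ?u))"
      using pd_matsD(3)[OF X] .
    also have "\<dots> = w \<bullet> (X *v w) - 2 * (v \<bullet> w) + v \<bullet> ?u"
      using sym_mats_inner_commute[OF pd_matsD(1)[OF X], of ?u w]
      by (simp add: matrix_vector_mult_diff_distrib inner_diff_left inner_diff_right
          matrix_inv_cancel[OF X] inner_commute)
    also have "v \<bullet> ?u \<le> v \<bullet> (Y *v v)"
      using D by (simp add: psd_mats_def matrix_vector_mult_diff_rdistrib inner_diff_right)
    finally show ?thesis
      by simp
  qed
  then show "Z \<in> ?H"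
    using Z Y pd_matsD(1)[OF X] by (simp add: inner_outer)
next
  fix Z :: "(real^'n^'n) \<times> (real^'n^'n)"
  assume "Z \<in> ?H"
  then obtain X Y where Z: "Z = (X, Y)" and X: "X \<in> sym_mats" and Y: "Y \<in> sym_mats"
    and H: "\<And>v w. 2 * (v \<bullet> w) \<le> w \<bullet> (X *v w) + v \<bullet> (Y *v v)"
    by (auto simp: inner_outer)
  have "0 < w \<bullet> (X *v w)" if "w \<noteq> 0" for w
  proof (rule ccontr)
    assume neg: "\<not> 0 < w \<bullet> (X *v w)"
    define q where "q = \<bar>w \<bullet> (Y *v w)\<bar> + 1"
    define t where "t = (w \<bullet> w) / q"
    have q: "q > 0" "w \<bullet> (Y *v w) \<le> q"
      by (auto simp: q_def)
    have ww: "w \<bullet> w > 0"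
      using that by simp
    have t: "t > 0" "t * q = w \<bullet> w"
      using q ww by (auto simp: t_def)
    \<comment> \<open>At \<open>v = t w\<close> the left-hand side is linear in \<open>t\<close> and the right-hand side at most quadratic,
      so small \<open>t\<close> contradicts the inequality; the value of \<open>t\<close> above is small enough.\<close>
    have "2 * (t * (w \<bullet> w)) \<le> t * (t * (w \<bullet> (Y *v w)))"
      using H[of "t *\<^sub>R w" w] neg by (simp add: matrix_vector_mult_scaleR)
    also have "\<dots> \<le> t * (t * q)"
      using q t by (intro mult_left_mono) auto
    finally have "2 * (w \<bullet> w) \<le> w \<bullet> w"
      using t by simp
    with ww show False
      by simp
  qed
  with X have X': "X \<in> pd_mats"
    by (simp add: pd_mats_def)
  have "0 \<le> v \<bullet> ((Y - matrix_inv X) *v v)" for v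
    using H[of v "matrix_inv X *v v"]
    by (simp add: matrix_vector_mult_diff_rdistrib inner_diff_right matrix_inv_cancel[OF X']
        inner_commute)
  then have "Y - matrix_inv X \<in> psd_mats"
    using Y matrix_inv_sym[OF X']
    by (simp add: psd_mats_def subspace_diff[OF subspace_sym_mats])
  with Z X' Y show "Z \<in> ?E"
    by (simp add: K_epi_def)
qed

lemma closed_epi_inverse:
  "closed (K_epi sym_mats pd_mats matrix_inv (psd_mats :: (real^'n^'n) set))"
  unfolding epi_inverse_eq_halfspaces
  by (intro closed_Int closed_Times closed_sym_mats closed_INT ballI closed_halfspace_ge)

lemma convex_epi_inverse:
  "convex (K_epi sym_mats pd_mats matrix_inv (psd_mats :: (real^'n^'n) set))"
  unfolding epi_inverse_eq_halfspaces
  by (intro convex_Int convex_Times convex_sym_mats convex_INT convex_halfspace_ge)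

section \<open>Minimality of the semidefinite cone\<close>

text \<open>
  The midpoint of the graph points over \<open>P\<inverse>\<close> and \<open>3 P\<inverse>\<close> lies above the graph by
  \<open>(1/2) (1 + 1/3) P - (1/2) P = (1/6) P\<close>.
\<close>

lemma psd_mats_subset_if_K_convex_inverse:
  fixes K :: "(real^'n^'n) set"
  assumes K: "closed_convex_cone_in sym_mats K"
    and conv: "K_convex sym_mats pd_mats matrix_inv K"
  shows "psd_mats \<subseteq> K"
proof (rule psd_mats_subset_closed)
  show "closed K"
    using K closed_sym_mats closedin_closed_trans
    unfolding closed_convex_cone_in_def by blast
  have cone: "convex_cone K"
    using K by (simp add: closed_convex_cone_in_def)
  have graph: "(X, matrix_inv X) \<in> K_epi sym_mats pd_mats matrix_inv K" if "X \<in> pd_mats" for X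
    using that cone matrix_inv_sym[OF that] by (simp add: K_epi_def convex_cone_contains_0)
  show "pd_mats \<subseteq> K"
  proof
    fix P :: "real^'n^'n"
    assume P: "P \<in> pd_mats"
    let ?Q = "matrix_inv P"
    have Q: "?Q \<in> pd_mats" "3 *\<^sub>R ?Q \<in> pd_mats"
      using matrix_inv_pd[OF P] scaleR_pd_mats[of ?Q 3] by simp_all
    have "(1/2) *\<^sub>R (?Q, matrix_inv ?Q) + (1/2) *\<^sub>R (3 *\<^sub>R ?Q, matrix_inv (3 *\<^sub>R ?Q))
        \<in> K_epi sym_mats pd_mats matrix_inv K"
      using conv graph Q unfolding K_convex_def by (intro convexD) auto
    moreover have "(1/2) *\<^sub>R ?Q + (1/2) *\<^sub>R 3 *\<^sub>R ?Q = 2 *\<^sub>R ?Q"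
      by (simp flip: scaleR_add_left)
    ultimately have "(1/2) *\<^sub>R P + (1/2) *\<^sub>R (1/3) *\<^sub>R P - (1/2) *\<^sub>R P \<in> K"
      by (simp add: K_epi_def matrix_inv_matrix_inv[OF P] matrix_inv_scaleR_matrix_inv[OF P])
    then have "(1/6) *\<^sub>R P \<in> K"
      by simp
    from convex_cone_scaleR[OF cone _ this, of 6] show "P \<in> K"
      by simp
  qed
qed

section \<open>The closed convex hull of the graph\<close>

text \<open>
  The convex combinations of \<open>(X, X\<inverse>)\<close> and \<open>(t P\<inverse>, (1/t) P)\<close> with weights \<open>1 - t\<close> and \<open>t\<close> tend to
  \<open>(X, X\<inverse> + P)\<close>: the second point escapes to infinity exactly as fast as its weight decays.
\<close>

lemma closed_convex_graph_superset:
  fixes C :: "((real^'n^'n) \<times> (real^'n^'n)) set"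
  assumes C: "closed C" "convex C" and graph: "gph pd_mats matrix_inv \<subseteq> C"
  shows "K_epi sym_mats pd_mats matrix_inv psd_mats \<subseteq> C"
proof -
  have mem: "(X, matrix_inv X) \<in> C" if "X \<in> pd_mats" for X
    using that graph by (auto simp: gph_def)
  have step: "(X, matrix_inv X + P) \<in> C" if X: "X \<in> pd_mats" and P: "P \<in> pd_mats" for X P
  proof -
    let ?f = "\<lambda>t::real. ((1 - t) *\<^sub>R X + (t * t) *\<^sub>R matrix_inv P, (1 - t) *\<^sub>R matrix_inv X + P)"
    have "?f t \<in> C" if t: "0 < t" "t < 1" for t
    proof -
      have "(1 - t) *\<^sub>R (X, matrix_inv X)
          + t *\<^sub>R (t *\<^sub>R matrix_inv P, matrix_inv (t *\<^sub>R matrix_inv P)) \<in> C"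
        using t by (intro convexD[OF C(2)] mem X scaleR_pd_mats matrix_inv_pd P) auto
      then show ?thesis
        using t by (simp add: matrix_inv_scaleR_matrix_inv[OF P])
    qed
    then have "\<forall>\<^sub>F t in at_right (0::real). ?f t \<in> C"
      by (intro eventually_at_rightI[of 0 1]) auto
    moreover have "(?f \<longlongrightarrow> ((1 - 0) *\<^sub>R X + (0 * 0) *\<^sub>R matrix_inv P, (1 - 0) *\<^sub>R matrix_inv X + P))
        (at_right (0::real))"
      by (intro tendsto_intros)
    ultimately show ?thesis
      using Lim_in_closed_set[OF C(1), of ?f "at_right (0::real)"] by simp
  qed
  have "(X, Y) \<in> C" if X: "X \<in> pd_mats" and Y: "Y - matrix_inv X \<in> psd_mats" for X Y
  proof -
    have "closed ((\<lambda>P. (X, matrix_inv X + P)) -` C)"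
      by (intro continuous_closed_vimage C(1) continuous_intros)
    then have "psd_mats \<subseteq> (\<lambda>P. (X, matrix_inv X + P)) -` C"
      using step[OF X] by (intro psd_mats_subset_closed) auto
    with Y show ?thesis
      by auto
  qed
  then show ?thesis
    by (auto simp: K_epi_def)
qed

lemma closed_conv_graph_inverse:
  "closed_conv_in (sym_mats \<times> sym_mats) (gph pd_mats matrix_inv)
    = K_epi sym_mats pd_mats matrix_inv (psd_mats :: (real^'n^'n) set)"
proof -
  let ?G = "gph pd_mats (matrix_inv :: real^'n^'n \<Rightarrow> _)"
  let ?S = "sym_mats \<times> sym_mats :: ((real^'n^'n) \<times> (real^'n^'n)) set"
  let ?E = "K_epi sym_mats pd_mats matrix_inv (psd_mats :: (real^'n^'n) set)"
  have "?G \<subseteq> ?E"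
    using convex_cone_contains_0[OF convex_cone_psd_mats]
    by (auto simp: gph_def K_epi_def matrix_inv_sym)
  then have hull: "convex hull ?G \<subseteq> ?E"
    by (intro hull_minimal convex_epi_inverse)
  have sub: "?E \<subseteq> ?S"
    by (auto simp: K_epi_def pd_matsD)
  have "closure (convex hull ?G) = ?E"
  proof (rule equalityI)
    show "closure (convex hull ?G) \<subseteq> ?E"
      by (intro closure_minimal hull closed_epi_inverse)
    show "?E \<subseteq> closure (convex hull ?G)"
      using hull_subset[of ?G convex] closure_subset[of "convex hull ?G"]
      by (intro closed_convex_graph_superset) (auto intro: convex_closure)
  qed
  moreover have "?S \<inter> convex hull ?G = convex hull ?G"
    using hull sub by blast
  ultimately show ?thesis
    using sub by (auto simp: closed_conv_in_def closure_of_subtopology)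
qed

theorem proposition51:
  fixes F :: "real^'n^'n \<Rightarrow> real^'n^'n"
  assumes "\<And>X. X \<in> pd_mats \<Longrightarrow> F X = matrix_inv X"
  shows "(is_K_hat sym_mats sym_mats pd_mats F psd_mats \<and> is_K sym_mats pd_mats F psd_mats)
    \<and> (K_convex sym_mats pd_mats F psd_mats \<and> K_closed sym_mats sym_mats pd_mats F psd_mats)
    \<and> closed_conv_in (sym_mats \<times> sym_mats) (gph pd_mats F) = K_epi sym_mats pd_mats F psd_mats"
proof -
  have epi: "K_epi sym_mats pd_mats F = K_epi sym_mats pd_mats matrix_inv"
    using assms by (auto simp: K_epi_def fun_eq_iff)
  have graph: "gph pd_mats F = gph pd_mats matrix_inv"
    using assms by (auto simp: gph_def)
  have convex: "K_convex sym_mats pd_mats F psd_mats"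
    by (simp add: K_convex_def epi convex_epi_inverse)
  have "K_epi sym_mats pd_mats F psd_mats \<subseteq> sym_mats \<times> sym_mats"
    by (auto simp: K_epi_def pd_matsD)
  then have closed: "K_closed sym_mats sym_mats pd_mats F psd_mats"
    by (simp add: K_closed_def epi closed_epi_inverse closed_subset)
  have cone: "closed_convex_cone_in sym_mats (psd_mats :: (real^'n^'n) set)"
    unfolding closed_convex_cone_in_def
    by (intro conjI convex_cone_psd_mats closed_subset closed_psd_mats) (auto simp: psd_mats_def)
  have minimal: "psd_mats \<subseteq> K"
    if "closed_convex_cone_in sym_mats K" "K_convex sym_mats pd_mats F K" for K
    using that psd_mats_subset_if_K_convex_inverse by (auto simp: K_convex_def epi)
  show ?thesis
    using convex closed cone minimal closed_conv_graph_inverse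
    by (auto simp: is_K_def is_K_hat_def smallest_closed_convex_cone_def epi graph)
qed

end
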